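(* For every $n\ge1$, the set $\mathcal P_n$ of partial involutions on $n$ letters is in bijection with the set $\mathcal E_n$ of skew-symmetric $(n,n)$-clans whose base clan is $\underbrace{-\cdots-}_{n}\underbrace{+\cdots+}_{n}$.
   Context: An $(n,n)$-clan is a string $\gamma=c_1\cdots c_{2n}$ of symbols from $\mathbb{N}\cup\{+,-\}$ such that each natural number appearing appears exactly twice and the numbers of $+$'s and $-$'s are equal; clans are equal if they have the same $\pm$ symbols in the same positions and the same sets of positions of matching pairs. $\gamma$ is skew-symmetric if $\gamma=-rev(\gamma)$, where $rev$ reverses the string and $-$ interchanges $+$ and $-$. The base clan of $\gamma$ is obtained by replacing, for each matching pair $c_i=c_j\in\mathbb N$ with $i<j$, the symbol $c_i$ by $-$ and $c_j$ by $+$. A partial permutation on $n$ letters is represented by an $n\times n$ $0/1$ matrix with at most one $1$ in each row and each column; a partial involution on $n$ letters is one whose matrix is symmetric. *)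

theory Defs
  imports "Jordan_Normal_Form.Matrix"
begin

definition partial_permutation_matrix :: "nat \<Rightarrow> int mat \<Rightarrow> bool" where
  "partial_permutation_matrix n A \<longleftrightarrow>
     A \<in> carrier_mat n n \<and> elements_mat A \<subseteq> {0, 1} \<and>
     (\<forall>i<n. card {j. j < n \<and> A $$ (i, j) = 1} \<le> 1) \<and>
     (\<forall>j<n. card {i. i < n \<and> A $$ (i, j) = 1} \<le> 1)"

text \<open>Partial permutations are identified with the matrices that represent them.\<close>

definition partial_involutions :: "nat \<Rightarrow> int mat set" where
  "partial_involutions n = {A. partial_permutation_matrix n A \<and> transpose_mat A = A}"

datatype clan_symbol = SPlus | SMinus | is_Mate: Mate nat

definition is_clan_string :: "clan_symbol list \<Rightarrow> bool" where
  "is_clan_string s \<longleftrightarrow> (\<forall>k. Mate k \<in> set s \<longrightarrow> count_list s (Mate k) = 2)"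

definition matching_pairs :: "clan_symbol list \<Rightarrow> (nat \<times> nat) set" where
  "matching_pairs s = {(i, j). i < j \<and> j < length s \<and> is_Mate (s ! i) \<and> s ! i = s ! j}"

definition clan_equiv :: "clan_symbol list \<Rightarrow> clan_symbol list \<Rightarrow> bool" where
  "clan_equiv s t \<longleftrightarrow>
     is_clan_string s \<and> is_clan_string t \<and> length s = length t \<and>
     (\<forall>i<length s. (s ! i = SPlus \<longleftrightarrow> t ! i = SPlus) \<and> (s ! i = SMinus \<longleftrightarrow> t ! i = SMinus)) \<and>
     matching_pairs s = matching_pairs t"

quotient_type clan = "clan_symbol list" / partial: clan_equiv
proof (rule part_equivpI)
  have "clan_equiv [] []"
    by (simp add: clan_equiv_def is_clan_string_def)
  then show "\<exists>s. clan_equiv s s" ..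
  show "symp clan_equiv"
    by (auto simp: symp_def clan_equiv_def)
  show "transp clan_equiv"
    by (auto simp: transp_def clan_equiv_def)
qed

lemma count_list_eq_card: "count_list s x = card {i. i < length s \<and> s ! i = x}"
  by (simp add: count_list_eq_length_filter length_filter_conv_card eq_commute)

lift_definition clan_length :: "clan \<Rightarrow> nat" is length
  by (simp add: clan_equiv_def)

lemma count_sign_cong:
  assumes "clan_equiv s t" "x = SPlus \<or> x = SMinus"
  shows "count_list s x = count_list t x"
proof -
  have "i < length s \<and> s ! i = x \<longleftrightarrow> i < length t \<and> t ! i = x" for i
    using assms unfolding clan_equiv_def by metis
  then show ?thesis
    by (simp add: count_list_eq_card)
qed

lift_definition clan_pluses :: "clan \<Rightarrow> nat" is "\<lambda>s. count_list s SPlus"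
  by (rule count_sign_cong) simp_all

lift_definition clan_minuses :: "clan \<Rightarrow> nat" is "\<lambda>s. count_list s SMinus"
  by (rule count_sign_cong) simp_all

definition nn_clans :: "nat \<Rightarrow> clan set" where
  "nn_clans n = {\<gamma>. clan_length \<gamma> = 2 * n \<and> clan_pluses \<gamma> = clan_minuses \<gamma>}"

fun flip_sign :: "clan_symbol \<Rightarrow> clan_symbol" where
  "flip_sign SPlus = SMinus"
| "flip_sign SMinus = SPlus"
| "flip_sign (Mate k) = Mate k"

lemma flip_sign_simps [simp]:
  "flip_sign x = SPlus \<longleftrightarrow> x = SMinus"
  "flip_sign x = SMinus \<longleftrightarrow> x = SPlus"
  "flip_sign x = Mate k \<longleftrightarrow> x = Mate k"
  "Mate k = flip_sign x \<longleftrightarrow> x = Mate k"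
  "is_Mate (flip_sign x) \<longleftrightarrow> is_Mate x"
  "flip_sign x = flip_sign y \<longleftrightarrow> x = y"
  by (cases x; cases y; auto)+

lemma is_clan_string_flip: "is_clan_string (map flip_sign s) \<longleftrightarrow> is_clan_string s"
proof -
  have "Mate k \<in> set (map flip_sign s) \<longleftrightarrow> Mate k \<in> set s"
    and "count_list (map flip_sign s) (Mate k) = count_list s (Mate k)" for k
    by (induction s) auto
  then show ?thesis
    by (simp add: is_clan_string_def)
qed

lemma matching_pairs_flip: "matching_pairs (map flip_sign s) = matching_pairs s"
  by (auto simp: matching_pairs_def)

lemma matching_pairs_rev:
  "matching_pairs (rev s) =
     {(i, j). i < j \<and> j < length s \<and> (length s - Suc j, length s - Suc i) \<in> matching_pairs s}"
proof -
  have "(i, j) \<in> matching_pairs (rev s) \<longleftrightarrow>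
      i < j \<and> j < length s \<and> (length s - Suc j, length s - Suc i) \<in> matching_pairs s" for i j
  proof (cases "i < j \<and> j < length s")
    case True
    then have "length s - Suc j < length s - Suc i" "length s - Suc i < length s"
      by arith+
    moreover have "rev s ! i = s ! (length s - Suc i)" "rev s ! j = s ! (length s - Suc j)"
      using True by (simp_all add: rev_nth)
    ultimately show ?thesis
      using True unfolding matching_pairs_def mem_Collect_eq case_prod_conv length_rev
      by metis
  next
    case False
    then show ?thesis
      by (auto simp: matching_pairs_def)
  qed
  then show ?thesis
    by auto
qed

lift_definition clan_neg :: "clan \<Rightarrow> clan" is "map flip_sign"
  by (simp add: clan_equiv_def is_clan_string_flip matching_pairs_flip)

lift_definition clan_rev :: "clan \<Rightarrow> clan" is rev
proof -
  fix s t assume st: "clan_equiv s t"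
  then have len: "length s = length t" and clan: "is_clan_string (rev s)" "is_clan_string (rev t)"
    and "matching_pairs (rev s) = matching_pairs (rev t)"
    by (simp_all add: clan_equiv_def is_clan_string_def matching_pairs_rev)
  moreover have "(rev s ! i = SPlus \<longleftrightarrow> rev t ! i = SPlus) \<and> (rev s ! i = SMinus \<longleftrightarrow> rev t ! i = SMinus)"
    if "i < length s" for i
  proof -
    have "length s - Suc i < length s"
      using that by arith
    then have "(s ! (length s - Suc i) = SPlus \<longleftrightarrow> t ! (length s - Suc i) = SPlus) \<and>
        (s ! (length s - Suc i) = SMinus \<longleftrightarrow> t ! (length s - Suc i) = SMinus)"
      using st unfolding clan_equiv_def by blast
    then show ?thesis
      using that len by (simp add: rev_nth)
  qed
  ultimately show "clan_equiv (rev s) (rev t)"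
    by (simp add: clan_equiv_def)
qed

definition skew_symmetric :: "clan \<Rightarrow> bool" where
  "skew_symmetric \<gamma> \<longleftrightarrow> \<gamma> = clan_neg (clan_rev \<gamma>)"

definition base_symbol :: "clan_symbol list \<Rightarrow> nat \<Rightarrow> clan_symbol" where
  "base_symbol s i =
     (if \<exists>j. (i, j) \<in> matching_pairs s then SMinus
      else if \<exists>j. (j, i) \<in> matching_pairs s then SPlus
      else s ! i)"

definition base_string :: "clan_symbol list \<Rightarrow> clan_symbol list" where
  "base_string s = map (base_symbol s) [0..<length s]"

lemma clan_string_mate:
  assumes "is_clan_string s" "i < length s" "is_Mate (s ! i)"
  shows "\<exists>j. (i, j) \<in> matching_pairs s \<or> (j, i) \<in> matching_pairs s"
proof -
  obtain k where k: "s ! i = Mate k"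
    using assms(3) by (cases "s ! i") auto
  have "Mate k \<in> set s"
    using assms(2) k nth_mem by metis
  then have "card {j. j < length s \<and> s ! j = Mate k} = 2"
    using assms(1) by (simp add: is_clan_string_def flip: count_list_eq_card)
  then obtain j where j: "j \<in> {j. j < length s \<and> s ! j = Mate k}" "j \<noteq> i"
    by (metis card_2_iff insertI1 insertI2)
  then have "i < j \<or> j < i"
    by arith
  then show ?thesis
    using assms(2) j k by (force simp: matching_pairs_def)
qed

lemma base_symbol_sign:
  assumes "is_clan_string s" "i < length s"
  shows "\<not> is_Mate (base_symbol s i)"
  using clan_string_mate[OF assms] by (auto simp: base_symbol_def)

lemma is_clan_string_signs: "(\<And>x. x \<in> set s \<Longrightarrow> \<not> is_Mate x) \<Longrightarrow> is_clan_string s"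
  by (force simp: is_clan_string_def)

lemma base_string_is_clan: "is_clan_string s \<Longrightarrow> is_clan_string (base_string s)"
  by (rule is_clan_string_signs) (auto simp: base_string_def base_symbol_sign)

lemma base_string_cong:
  assumes "clan_equiv s t"
  shows "base_string s = base_string t"
proof (rule nth_equalityI)
  show "length (base_string s) = length (base_string t)"
    using assms by (simp add: base_string_def clan_equiv_def)
  fix i assume "i < length (base_string s)"
  then have i: "i < length s" "i < length t"
    using assms by (simp_all add: base_string_def clan_equiv_def)
  have mp: "matching_pairs t = matching_pairs s"
    and plus: "t ! i = SPlus \<longleftrightarrow> s ! i = SPlus"
    and minus: "t ! i = SMinus \<longleftrightarrow> s ! i = SMinus"
    and clan: "is_clan_string s" "is_clan_string t"
    using assms i by (simp_all add: clan_equiv_def)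
  have "base_symbol s i = base_symbol t i"
  proof (cases "\<exists>j. (i, j) \<in> matching_pairs s \<or> (j, i) \<in> matching_pairs s")
    case True
    then show ?thesis
      by (auto simp: base_symbol_def mp)
  next
    case False
    then have "\<not> is_Mate (s ! i)" "\<not> is_Mate (t ! i)"
      using clan_string_mate[OF clan(1) i(1)] clan_string_mate[OF clan(2) i(2)]
      by (auto simp: mp)
    then have "s ! i = t ! i"
      using plus minus by (cases "s ! i"; cases "t ! i") simp_all
    with False show ?thesis
      by (simp add: base_symbol_def mp)
  qed
  then show "base_string s ! i = base_string t ! i"
    using i by (simp add: base_string_def)
qed

lift_definition base_clan :: "clan \<Rightarrow> clan" is base_string
proof -
  fix s t assume st: "clan_equiv s t"
  then have "is_clan_string (base_string s)"
    by (simp add: clan_equiv_def base_string_is_clan)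
  then show "clan_equiv (base_string s) (base_string t)"
    by (simp add: clan_equiv_def flip: base_string_cong[OF st])
qed

lift_definition minus_plus_clan :: "nat \<Rightarrow> clan" is
  "\<lambda>n. replicate n SMinus @ replicate n SPlus"
  by (auto simp: clan_equiv_def intro!: is_clan_string_signs)

definition skew_symmetric_clans_over_minus_plus :: "nat \<Rightarrow> clan set" where
  "skew_symmetric_clans_over_minus_plus n =
     {\<gamma> \<in> nn_clans n. skew_symmetric \<gamma> \<and> base_clan \<gamma> = minus_plus_clan n}"

end

theory Submission
  imports Defs
begin

text \<open>
  A clan over \<open>- \<dots> - + \<dots> +\<close> matches positions of the first half with positions of the second half,
  and its signs are determined by the matched pairs. Numbering the second half from right to left
  turns its matching into a partial permutation of \<open>n\<close> letters. Under this numbering, reversal of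
  the clan swaps the two ends of each pair, that is, transposes the matrix.
\<close>

section \<open>Clans, their representing strings and their matchings\<close>

lemma clan_equiv_refl_iff: "clan_equiv s s \<longleftrightarrow> is_clan_string s"
  by (simp add: clan_equiv_def)

lemma abs_clan_eq_iff:
  assumes "is_clan_string s" "is_clan_string t"
  shows "abs_clan s = abs_clan t \<longleftrightarrow> clan_equiv s t"
  using Quotient3_rel[OF Quotient3_clan, of s t] assms by (simp add: clan_equiv_refl_iff)

lemma abs_clan_cases:
  obtains s where "is_clan_string s" "\<gamma> = abs_clan s"
proof (induction \<gamma> rule: clan.abs_induct)
  case (1 s)
  then show ?case by (simp add: clan_equiv_refl_iff)
qed

lemma is_Mate_iff_matched:
  assumes "is_clan_string s" "i < length s"
  shows "is_Mate (s ! i) \<longleftrightarrow> (\<exists>j. (i, j) \<in> matching_pairs s \<or> (j, i) \<in> matching_pairs s)"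
  using clan_string_mate[OF assms] by (auto simp: matching_pairs_def)

text \<open>Without mates there are no labels to rename, so the sign conditions of
  \<open>clan_equiv\<close> compare every symbol.\<close>

lemma clan_equiv_signs_eq:
  assumes "clan_equiv s t" "\<And>x. x \<in> set s \<Longrightarrow> \<not> is_Mate x" "\<And>x. x \<in> set t \<Longrightarrow> \<not> is_Mate x"
  shows "s = t"
proof (rule nth_equalityI)
  show len: "length s = length t"
    using assms(1) by (simp add: clan_equiv_def)
  fix i assume i: "i < length s"
  then have "\<not> is_Mate (s ! i)" "\<not> is_Mate (t ! i)"
    using assms(2,3) len by simp_all
  moreover have "s ! i = SPlus \<longleftrightarrow> t ! i = SPlus" "s ! i = SMinus \<longleftrightarrow> t ! i = SMinus"
    using assms(1) i by (simp_all add: clan_equiv_def)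
  ultimately show "s ! i = t ! i"
    by (cases "s ! i"; cases "t ! i") simp_all
qed

text \<open>A shared position forces a common label on both pairs. A label occupies exactly two
  positions, so the pairs agree as sets, and also as ordered pairs since both are
  increasing.\<close>

lemma matching_pairs_unique:
  assumes "is_clan_string s" "p \<in> matching_pairs s" "q \<in> matching_pairs s"
    and "{fst p, snd p} \<inter> {fst q, snd q} \<noteq> {}"
  shows "p = q"
proof -
  obtain i j where p: "p = (i, j)" by (cases p)
  obtain k l where q: "q = (k, l)" by (cases q)
  obtain m where m: "s ! i = Mate m"
    using assms(2) p by (cases "s ! i") (auto simp: matching_pairs_def)
  have ij: "i < j" "j < length s" "s ! j = Mate m" and kl: "k < l" "l < length s"
    using assms(2,3) m by (auto simp: p q matching_pairs_def)
  have sk: "s ! k = Mate m" "s ! l = Mate m"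
    using assms(2-4) m by (auto simp: p q matching_pairs_def)
  let ?C = "{x. x < length s \<and> s ! x = Mate m}"
  have "Mate m \<in> set s"
    using ij nth_mem by metis
  then have "card ?C = 2"
    using assms(1) by (simp add: is_clan_string_def flip: count_list_eq_card)
  moreover have "card {i, j} = 2" "card {k, l} = 2"
    using ij kl by simp_all
  moreover have "{i, j} \<subseteq> ?C" "{k, l} \<subseteq> ?C"
    using ij kl sk m by auto
  moreover have "finite ?C" by simp
  ultimately have "{i, j} = {k, l}"
    by (metis card_subset_eq)
  then show ?thesis
    using ij kl by (auto simp: p q doubleton_eq_iff)
qed

text \<open>Supplies the clan needed for surjectivity. Each pair is labelled by its smaller
  position; disjointness of the pairs makes these labels distinct.\<close>

lemma ex_clan_string:
  fixes M :: "(nat \<times> nat) set" and sign :: "nat \<Rightarrow> clan_symbol"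
  assumes bounds: "\<And>i j. (i, j) \<in> M \<Longrightarrow> i < j \<and> j < m"
    and unique: "\<And>p q. p \<in> M \<Longrightarrow> q \<in> M \<Longrightarrow> {fst p, snd p} \<inter> {fst q, snd q} \<noteq> {} \<Longrightarrow> p = q"
    and sign: "\<And>i. \<not> is_Mate (sign i)"
  obtains s where "is_clan_string s" "length s = m" "matching_pairs s = M"
    "\<And>i. i < m \<Longrightarrow> \<not> is_Mate (s ! i) \<Longrightarrow> s ! i = sign i"
proof
  \<comment> \<open>The choice is forced: by \<open>unique\<close> at most one pair passes through
    \<open>i\<close>.\<close>
  define sym where "sym i = (if \<exists>p\<in>M. i \<in> {fst p, snd p}
    then Mate (fst (SOME p. p \<in> M \<and> i \<in> {fst p, snd p})) else sign i)" for i
  define s where "s = map sym [0..<m]"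
  have bounds': "fst p < snd p" "snd p < m" if "p \<in> M" for p
    using bounds[of "fst p" "snd p"] that by simp_all
  have some: "(SOME p. p \<in> M \<and> x \<in> {fst p, snd p}) = q" if "q \<in> M" "x \<in> {fst q, snd q}" for q x
    by (rule some_equality) (use that unique in blast)+
  have sym_Mate: "sym x = Mate (fst q)" if "q \<in> M" "x \<in> {fst q, snd q}" for q x
    using that some[OF that] unfolding sym_def by auto
  have sym_MateD: "\<exists>q\<in>M. x \<in> {fst q, snd q} \<and> fst q = k" if "sym x = Mate k" for x k
  proof (cases "\<exists>q\<in>M. x \<in> {fst q, snd q}")
    case True
    then show ?thesis
      using sym_Mate that by fastforce
  next
    case False
    then have "sym x = sign x"
      unfolding sym_def by (rule if_not_P)
    then show ?thesis
      using sign[of x] arg_cong[OF that, of is_Mate] by simp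
  qed
  show len: "length s = m"
    by (simp add: s_def)
  have nth: "s ! i = sym i" if "i < m" for i
    using that by (simp add: s_def)
  \<comment> \<open>A label \<open>fst p\<close> marks the two ends of \<open>p\<close> and nothing
    else. Both the count of two and the recovery of \<open>M\<close> from the string rest on
    this.\<close>
  have class_eq: "{x. x < m \<and> s ! x = Mate (fst p)} = {fst p, snd p}" if p: "p \<in> M" for p
  proof -
    have lt: "fst p < m" "snd p < m"
      using bounds'[OF p] by simp_all
    have "x \<in> {fst p, snd p}" if x: "x < m" "s ! x = Mate (fst p)" for x
    proof -
      have "sym x = Mate (fst p)"
        using x nth by simp
      from sym_MateD[OF this] obtain q where q: "q \<in> M" "x \<in> {fst q, snd q}" "fst q = fst p"
        by blast
      have "fst p \<in> {fst p, snd p} \<inter> {fst q, snd q}"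
        by (simp add: q(3))
      then have "{fst p, snd p} \<inter> {fst q, snd q} \<noteq> {}"
        by blast
      then have "p = q"
        by (rule unique[OF p q(1)])
      then show ?thesis
        using q(2) by simp
    qed
    moreover have "s ! fst p = Mate (fst p)" "s ! snd p = Mate (fst p)"
      using lt by (simp_all add: nth sym_Mate[OF p])
    ultimately show ?thesis
      using lt by blast
  qed
  show "is_clan_string s"
    unfolding is_clan_string_def
  proof (intro allI impI)
    fix k assume "Mate k \<in> set s"
    then obtain x where "x < m" "sym x = Mate k"
      by (auto simp: s_def)
    then obtain p where p: "p \<in> M" "fst p = k"
      using sym_MateD by blast
    have "fst p < snd p"
      by (rule bounds'[OF p(1)])
    then show "count_list s (Mate k) = 2"
      using class_eq[OF p(1)] by (simp add: count_list_eq_card len p(2))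
  qed
  show "matching_pairs s = M"
  proof (intro equalityI subsetI)
    fix p assume p: "p \<in> matching_pairs s"
    obtain i j where ij: "p = (i, j)" "i < j" "j < m" "is_Mate (s ! i)" "s ! i = s ! j"
      using p by (auto simp: matching_pairs_def len)
    obtain k where k: "s ! i = Mate k"
      using ij(4) by (cases "s ! i") auto
    then have "sym i = Mate k"
      using nth[of i] ij by simp
    from sym_MateD[OF this] obtain q where q: "q \<in> M" "fst q = k"
      by blast
    have "i \<in> {x. x < m \<and> s ! x = Mate (fst q)}" "j \<in> {x. x < m \<and> s ! x = Mate (fst q)}"
      using ij k q by simp_all
    then have "i \<in> {fst q, snd q}" "j \<in> {fst q, snd q}"
      unfolding class_eq[OF q(1)] .
    moreover have "fst q < snd q"
      by (rule bounds'[OF q(1)])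
    ultimately have "p = q"
      using ij by (cases q) auto
    then show "p \<in> M"
      using q by simp
  next
    fix p assume p: "p \<in> M"
    obtain i j where ij: "p = (i, j)" by (cases p)
    have "i < j" "j < m"
      using bounds p ij by auto
    then show "p \<in> matching_pairs s"
      using sym_Mate[OF p] by (simp add: matching_pairs_def len nth ij)
  qed
  show "s ! i = sign i" if i: "i < m" "\<not> is_Mate (s ! i)" for i
  proof -
    have "\<not> (\<exists>p\<in>M. i \<in> {fst p, snd p})"
      using i sym_Mate[of _ i] nth[OF i(1)] by auto
    then have "sym i = sign i"
      unfolding sym_def by (rule if_not_P)
    then show ?thesis
      by (simp add: nth i(1))
  qed
qed

section \<open>Clan strings over the prescribed base\<close>

text \<open>The base puts \<open>SMinus\<close> at left ends and \<open>SPlus\<close> at right ends,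
  so this base forces left ends into the first half and right ends into the second; unmatched
  positions keep their own sign.\<close>

lemma base_string_minus_plus_iff:
  assumes "is_clan_string s"
  shows "base_string s = replicate n SMinus @ replicate n SPlus \<longleftrightarrow>
    length s = 2 * n \<and> (\<forall>(i, j) \<in> matching_pairs s. i < n \<and> n \<le> j) \<and>
    (\<forall>i<2 * n. \<not> is_Mate (s ! i) \<longrightarrow> s ! i = (if i < n then SMinus else SPlus))"
    (is "?base \<longleftrightarrow> ?len \<and> ?cross \<and> ?sign")
proof
  assume base: ?base
  have len: ?len
    using arg_cong[OF base, of length] by (simp add: base_string_def)
  have sym: "base_symbol s i = (if i < n then SMinus else SPlus)" if "i < 2 * n" for i
  proof -
    have "base_symbol s i = base_string s ! i"
      using that len by (simp add: base_string_def)
    then show ?thesis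
      using that by (simp add: base nth_append)
  qed
  have ?cross
  proof (clarify)
    fix i j assume ij: "(i, j) \<in> matching_pairs s"
    then have lt: "i < 2 * n" "j < 2 * n" "i < j"
      by (auto simp: matching_pairs_def len)
    have "base_symbol s i = SMinus"
      using ij by (auto simp: base_symbol_def)
    then have "i < n"
      using sym[OF lt(1)] by (simp split: if_splits)
    \<comment> \<open>\<open>base_symbol\<close> tests for a left end first, so \<open>j\<close>
      yields \<open>SPlus\<close> only once it is known not to open another pair.\<close>
    have "(j, k) \<notin> matching_pairs s" for k
      using matching_pairs_unique[OF assms ij, of "(j, k)"] lt by auto
    then have "base_symbol s j = SPlus"
      using ij by (auto simp: base_symbol_def)
    then have "n \<le> j"
      using sym[OF lt(2)] by (simp split: if_splits)
    with \<open>i < n\<close> show "i < n \<and> n \<le> j" ..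
  qed
  moreover have ?sign
  proof (intro allI impI)
    fix i assume i: "i < 2 * n" "\<not> is_Mate (s ! i)"
    then have "base_symbol s i = s ! i"
      using is_Mate_iff_matched[OF assms, of i] by (simp add: base_symbol_def len)
    then show "s ! i = (if i < n then SMinus else SPlus)"
      using sym i by simp
  qed
  ultimately show "?len \<and> ?cross \<and> ?sign"
    using len by blast
next
  assume rhs: "?len \<and> ?cross \<and> ?sign"
  show ?base
  proof (rule nth_equalityI)
    show "length (base_string s) = length (replicate n SMinus @ replicate n SPlus)"
      using rhs by (simp add: base_string_def)
    fix i assume "i < length (base_string s)"
    then have i: "i < 2 * n" "i < length s"
      using rhs by (simp_all add: base_string_def)
    have "base_symbol s i = (if i < n then SMinus else SPlus)"
    proof (cases "\<exists>j. (i, j) \<in> matching_pairs s \<or> (j, i) \<in> matching_pairs s")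
      case True
      then consider j where "(i, j) \<in> matching_pairs s" "i < n"
        | j where "(j, i) \<in> matching_pairs s" "n \<le> i"
        using rhs by blast
      then show ?thesis
      proof cases
        case 1
        then show ?thesis by (auto simp: base_symbol_def)
      next
        case 2
        \<comment> \<open>A left end would lie in the first half by \<open>?cross\<close>, but here
          \<open>n \<le> i\<close>.\<close>
        then have "(i, k) \<notin> matching_pairs s" for k
          using rhs by fastforce
        with 2 show ?thesis by (auto simp: base_symbol_def)
      qed
    next
      case False
      then have "\<not> is_Mate (s ! i)"
        using is_Mate_iff_matched[OF assms i(2)] by simp
      then have "s ! i = (if i < n then SMinus else SPlus)"
        using rhs i by blast
      then show ?thesis
        using False by (simp add: base_symbol_def)
    qed
    then show "base_string s ! i = (replicate n SMinus @ replicate n SPlus) ! i"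
      using i by (simp add: base_string_def nth_append)
  qed
qed

text \<open>Base strings consist of signs, where equivalence is equality, so the equation between
  clans can be tested on strings.\<close>

lemma base_clan_abs_eq_iff:
  assumes "is_clan_string s"
  shows "base_clan (abs_clan s) = minus_plus_clan n \<longleftrightarrow>
    base_string s = replicate n SMinus @ replicate n SPlus"
proof -
  have signs: "\<not> is_Mate x" if "x \<in> set (base_string s)" for x
    using that base_symbol_sign[OF assms] by (auto simp: base_string_def)
  have signs': "\<not> is_Mate x" if "x \<in> set (replicate n SMinus @ replicate n SPlus)" for x
    using that by auto
  let ?t = "replicate n SMinus @ replicate n SPlus"
  have clan: "is_clan_string (base_string s)" "is_clan_string ?t"
    using signs signs' by (blast intro: is_clan_string_signs)+
  have "base_clan (abs_clan s) = abs_clan (base_string s)"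
    using assms by (simp add: base_clan.abs_eq clan_equiv_refl_iff)
  then have "base_clan (abs_clan s) = minus_plus_clan n \<longleftrightarrow> clan_equiv (base_string s) ?t"
    by (simp only: minus_plus_clan_def map_fun_apply id_apply abs_clan_eq_iff[OF clan])
  also have "\<dots> \<longleftrightarrow> base_string s = ?t"
  proof
    show "clan_equiv (base_string s) ?t \<Longrightarrow> base_string s = ?t"
      by (rule clan_equiv_signs_eq[OF _ signs signs'])
    show "base_string s = ?t \<Longrightarrow> clan_equiv (base_string s) ?t"
      using clan(2) by (simp only: clan_equiv_refl_iff)
  qed
  finally show ?thesis .
qed

lemma skew_symmetric_abs_iff:
  assumes "is_clan_string s"
  shows "skew_symmetric (abs_clan s) \<longleftrightarrow> clan_equiv s (map flip_sign (rev s))"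
proof -
  have rev: "is_clan_string (rev s)"
    using assms by (simp add: is_clan_string_def)
  then have "clan_neg (clan_rev (abs_clan s)) = abs_clan (map flip_sign (rev s))"
    using assms by (simp add: clan_rev.abs_eq clan_neg.abs_eq clan_equiv_refl_iff)
  then show ?thesis
    using abs_clan_eq_iff assms rev by (simp add: skew_symmetric_def is_clan_string_flip)
qed

lemma count_list_map_flip_sign: "count_list (map flip_sign s) SPlus = count_list s SMinus"
  by (induction s) auto

text \<open>Reversal preserves the number of each sign and negation exchanges the two numbers. This
  gives the sign condition of \<open>nn_clans\<close> when membership is characterized
  below.\<close>

lemma skew_symmetric_count:
  assumes "is_clan_string s" "skew_symmetric (abs_clan s)"
  shows "clan_pluses (abs_clan s) = clan_minuses (abs_clan s)"
proof -
  have "count_list s SPlus = count_list (map flip_sign (rev s)) SPlus"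
    using assms by (intro count_sign_cong) (simp_all add: skew_symmetric_abs_iff)
  then show ?thesis
    using assms by (simp only: count_list_map_flip_sign count_list_rev)
      (simp add: clan_pluses.abs_eq clan_minuses.abs_eq clan_equiv_refl_iff)
qed

definition minus_plus_string :: "nat \<Rightarrow> clan_symbol list \<Rightarrow> bool" where
  "minus_plus_string n s \<longleftrightarrow> is_clan_string s \<and>
     base_string s = replicate n SMinus @ replicate n SPlus"

lemma minus_plus_string_simps:
  assumes "minus_plus_string n s"
  shows "is_clan_string s" "length s = 2 * n"
    and "(i, j) \<in> matching_pairs s \<Longrightarrow> i < n \<and> n \<le> j \<and> j < 2 * n"
    and "i < 2 * n \<Longrightarrow> \<not> is_Mate (s ! i) \<Longrightarrow> s ! i = (if i < n then SMinus else SPlus)"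
proof -
  have props: "is_clan_string s" "length s = 2 * n" "\<forall>(i, j) \<in> matching_pairs s. i < n \<and> n \<le> j"
    "\<forall>i<2 * n. \<not> is_Mate (s ! i) \<longrightarrow> s ! i = (if i < n then SMinus else SPlus)"
    using assms base_string_minus_plus_iff[of s n] unfolding minus_plus_string_def by blast+
  then show "is_clan_string s" "length s = 2 * n"
    "i < 2 * n \<Longrightarrow> \<not> is_Mate (s ! i) \<Longrightarrow> s ! i = (if i < n then SMinus else SPlus)"
    by blast+
  assume ij: "(i, j) \<in> matching_pairs s"
  then have "j < 2 * n"
    using props(2) by (simp add: matching_pairs_def)
  then show "i < n \<and> n \<le> j \<and> j < 2 * n"
    using ij props(3) by blast
qed

text \<open>The matching decides which positions hold mates, and every other symbol is dictated by
  its half. A clan over this base is thus determined by its matching.\<close>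

lemma minus_plus_clan_equivI:
  assumes s: "minus_plus_string n s" and t: "minus_plus_string n t"
    and eq: "matching_pairs s = matching_pairs t"
  shows "clan_equiv s t"
proof -
  have "(s ! i = SPlus \<longleftrightarrow> t ! i = SPlus) \<and> (s ! i = SMinus \<longleftrightarrow> t ! i = SMinus)"
    if i: "i < 2 * n" for i
  proof -
    have "is_Mate (s ! i) \<longleftrightarrow> is_Mate (t ! i)"
      using is_Mate_iff_matched[of s i] is_Mate_iff_matched[of t i] i eq
        minus_plus_string_simps(1,2)[OF s] minus_plus_string_simps(1,2)[OF t] by simp
    then show ?thesis
      using minus_plus_string_simps(4)[OF s i] minus_plus_string_simps(4)[OF t i]
      by (cases "is_Mate (s ! i)") (auto simp: is_Mate_def)
  qed
  then show ?thesis
    using eq minus_plus_string_simps(1,2)[OF s] minus_plus_string_simps(1,2)[OF t]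
    by (simp add: clan_equiv_def)
qed

text \<open>Reversal exchanges the halves and flipping exchanges the signs, so the sign pattern
  survives. A pair \<open>(i, j)\<close> becomes \<open>(2 * n - Suc j, 2 * n - Suc i)\<close>,
  which again crosses the middle.\<close>

lemma minus_plus_string_flip_rev:
  assumes s: "minus_plus_string n s"
  shows "minus_plus_string n (map flip_sign (rev s))"
proof -
  let ?t = "map flip_sign (rev s)"
  note simps = minus_plus_string_simps[OF s]
  have clan: "is_clan_string ?t"
    using simps(1) by (simp only: is_clan_string_flip) (simp add: is_clan_string_def)
  have "i < n \<and> n \<le> j" if "(i, j) \<in> matching_pairs ?t" for i j
  proof -
    have "(2 * n - Suc j, 2 * n - Suc i) \<in> matching_pairs s" "i < j" "j < 2 * n"
      using that by (auto simp: matching_pairs_flip matching_pairs_rev simps(2))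
    then show ?thesis
      using simps(3) by fastforce
  qed
  moreover have "?t ! i = (if i < n then SMinus else SPlus)"
    if "i < 2 * n" "\<not> is_Mate (?t ! i)" for i
  proof -
    have "?t ! i = flip_sign (s ! (2 * n - Suc i))"
      using that by (simp add: rev_nth simps(2))
    moreover from this have "\<not> is_Mate (s ! (2 * n - Suc i))"
      using that by simp
    ultimately show ?thesis
      using simps(4)[of "2 * n - Suc i"] that by auto
  qed
  ultimately show ?thesis
    using base_string_minus_plus_iff[OF clan, of n] clan simps(2)
    by (auto simp: minus_plus_string_def)
qed

text \<open>The negated reversal has the same base, so its signs agree as soon as the matchings do:
  skew-symmetry reduces to invariance of the matching under reversal.\<close>

lemma abs_clan_over_minus_plus_iff:
  assumes "is_clan_string s"
  shows "abs_clan s \<in> skew_symmetric_clans_over_minus_plus n \<longleftrightarrow>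
    minus_plus_string n s \<and> matching_pairs (rev s) = matching_pairs s"
    (is "?lhs \<longleftrightarrow> ?rhs")
proof
  assume ?lhs
  then show ?rhs
    using assms by (auto simp: skew_symmetric_clans_over_minus_plus_def minus_plus_string_def
        base_clan_abs_eq_iff skew_symmetric_abs_iff clan_equiv_def matching_pairs_flip)
next
  assume rhs: ?rhs
  then have "clan_equiv s (map flip_sign (rev s))"
    by (intro minus_plus_clan_equivI[of n] minus_plus_string_flip_rev) (simp_all add: matching_pairs_flip)
  moreover have "clan_length (abs_clan s) = 2 * n"
    using rhs minus_plus_string_simps(2)[of n s] assms
    by (simp add: clan_length.abs_eq clan_equiv_refl_iff)
  ultimately show ?lhs
    using assms rhs skew_symmetric_count[OF assms]
    by (simp add: skew_symmetric_clans_over_minus_plus_def minus_plus_string_def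
        base_clan_abs_eq_iff skew_symmetric_abs_iff nn_clans_def)
qed

section \<open>The matrix of a clan\<close>

lift_definition clan_pairs :: "clan \<Rightarrow> (nat \<times> nat) set" is matching_pairs
  by (simp add: clan_equiv_def)

lemma clan_pairs_abs: "is_clan_string s \<Longrightarrow> clan_pairs (abs_clan s) = matching_pairs s"
  by (simp add: clan_pairs.abs_eq clan_equiv_refl_iff)

text \<open>Positions count from zero: column \<open>0\<close> stands for the last position
  \<open>2 * n - 1\<close>, and column \<open>n - 1\<close> for position \<open>n\<close>.\<close>

definition clan_matrix :: "nat \<Rightarrow> clan \<Rightarrow> int mat" where
  "clan_matrix n \<gamma> = mat n n (\<lambda>(i, j). if (i, 2 * n - Suc j) \<in> clan_pairs \<gamma> then 1 else 0)"

text \<open>Turns the cardinality bounds into uniqueness of the ones in each row and column, the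
  form that matches disjointness of pairs.\<close>

lemma partial_permutation_matrix_iff:
  "partial_permutation_matrix n A \<longleftrightarrow>
     A \<in> carrier_mat n n \<and> (\<forall>i<n. \<forall>j<n. A $$ (i, j) \<in> {0, 1}) \<and>
     (\<forall>i<n. \<forall>j<n. \<forall>k<n. A $$ (i, j) = 1 \<longrightarrow> A $$ (i, k) = 1 \<longrightarrow> j = k) \<and>
     (\<forall>i<n. \<forall>j<n. \<forall>k<n. A $$ (i, k) = 1 \<longrightarrow> A $$ (j, k) = 1 \<longrightarrow> i = j)"
proof (cases "A \<in> carrier_mat n n")
  case True
  then have elems: "elements_mat A \<subseteq> {0, 1} \<longleftrightarrow> (\<forall>i<n. \<forall>j<n. A $$ (i, j) \<in> {0, 1})"
    unfolding elements_mat_def by fastforce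
  have card: "card {j. j < n \<and> P j} \<le> 1 \<longleftrightarrow> (\<forall>j<n. \<forall>k<n. P j \<longrightarrow> P k \<longrightarrow> j = k)" for P
    by (auto simp: card_le_Suc0_iff_eq)
  have swap: "(\<forall>k<n. \<forall>i<n. \<forall>j<n. P i k \<longrightarrow> P j k \<longrightarrow> i = j) \<longleftrightarrow>
      (\<forall>i<n. \<forall>j<n. \<forall>k<n. P i k \<longrightarrow> P j k \<longrightarrow> i = j)" for P :: "nat \<Rightarrow> nat \<Rightarrow> bool"
    by blast
  show ?thesis
    unfolding partial_permutation_matrix_def elems card swap by (rule refl)
next
  case False
  then show ?thesis
    by (simp add: partial_permutation_matrix_def)
qed

text \<open>Two ones in a row would be two pairs with the same left end. Invariance under reversal
  makes the matrix symmetric, and symmetry carries the row condition over to columns.\<close>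

lemma clan_matrix_in_partial_involutions:
  assumes "\<gamma> \<in> skew_symmetric_clans_over_minus_plus n"
  shows "clan_matrix n \<gamma> \<in> partial_involutions n"
proof -
  obtain s where s: "is_clan_string s" "\<gamma> = abs_clan s"
    by (rule abs_clan_cases)
  have mp: "minus_plus_string n s" and rev: "matching_pairs (rev s) = matching_pairs s"
    using assms s by (simp_all add: abs_clan_over_minus_plus_iff)
  let ?M = "matching_pairs s"
  \<comment> \<open>Reversal sends the pair of entry \<open>(i, j)\<close> to the pair of entry
    \<open>(j, i)\<close>.\<close>
  have swap: "(j, 2 * n - Suc i) \<in> ?M" if "i < n" "j < n" "(i, 2 * n - Suc j) \<in> ?M" for i j
  proof -
    have "(i, 2 * n - Suc j) \<in> matching_pairs (rev s)"
      using that rev by simp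
    then have "(2 * n - Suc (2 * n - Suc j), 2 * n - Suc i) \<in> ?M"
      using minus_plus_string_simps(2)[OF mp] by (simp add: matching_pairs_rev)
    moreover have "2 * n - Suc (2 * n - Suc j) = j"
      using that by simp
    ultimately show ?thesis by simp
  qed
  have entry: "clan_matrix n \<gamma> $$ (i, j) = (if (i, 2 * n - Suc j) \<in> ?M then 1 else 0)"
    if "i < n" "j < n" for i j
    using that s by (simp add: clan_matrix_def clan_pairs_abs)
  have carrier: "clan_matrix n \<gamma> \<in> carrier_mat n n"
    by (simp add: clan_matrix_def)
  have row: "j = k" if "i < n" "j < n" "k < n" "clan_matrix n \<gamma> $$ (i, j) = 1"
    "clan_matrix n \<gamma> $$ (i, k) = 1" for i j k
    using that matching_pairs_unique[OF s(1), of "(i, 2 * n - Suc j)" "(i, 2 * n - Suc k)"]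
    by (auto simp: entry split: if_splits)
  have sym: "clan_matrix n \<gamma> $$ (j, i) = clan_matrix n \<gamma> $$ (i, j)" if "i < n" "j < n" for i j
    using swap that by (auto simp: entry)
  have "transpose_mat (clan_matrix n \<gamma>) = clan_matrix n \<gamma>"
    using carrier sym by (intro eq_matI) auto
  moreover have "partial_permutation_matrix n (clan_matrix n \<gamma>)"
    unfolding partial_permutation_matrix_iff
    using carrier row sym by (auto simp: entry)
  ultimately show ?thesis
    by (simp add: partial_involutions_def)
qed

text \<open>Every pair crosses the middle and is therefore recorded by a matrix entry, so equal
  matrices give equal matchings and hence equal clans.\<close>

lemma clan_matrix_inj_on: "inj_on (clan_matrix n) (skew_symmetric_clans_over_minus_plus n)"
proof (rule inj_onI)
  fix \<gamma> \<delta> assume in_E: "\<gamma> \<in> skew_symmetric_clans_over_minus_plus n"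
      "\<delta> \<in> skew_symmetric_clans_over_minus_plus n"
    and eq: "clan_matrix n \<gamma> = clan_matrix n \<delta>"
  obtain s where s: "is_clan_string s" "\<gamma> = abs_clan s" by (rule abs_clan_cases)
  obtain t where t: "is_clan_string t" "\<delta> = abs_clan t" by (rule abs_clan_cases)
  have mp: "minus_plus_string n s" "minus_plus_string n t"
    using in_E s t by (simp_all add: abs_clan_over_minus_plus_iff)
  have iff: "(i, 2 * n - Suc j) \<in> matching_pairs s \<longleftrightarrow> (i, 2 * n - Suc j) \<in> matching_pairs t"
    if "i < n" "j < n" for i j
    using arg_cong[OF eq, of "\<lambda>A. A $$ (i, j)"] that s t
    by (simp add: clan_matrix_def clan_pairs_abs split: if_splits)
  have "(i, j) \<in> matching_pairs s \<longleftrightarrow> (i, j) \<in> matching_pairs t" for i j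
  proof (cases "i < n \<and> n \<le> j \<and> j < 2 * n")
    case True
    \<comment> \<open>The reflection is its own inverse and takes positions of the second half to
      column indices.\<close>
    then have "2 * n - Suc (2 * n - Suc j) = j" "2 * n - Suc j < n" by auto
    then show ?thesis
      using iff[of i "2 * n - Suc j"] True by simp
  next
    case False
    then show ?thesis
      using minus_plus_string_simps(3)[OF mp(1)] minus_plus_string_simps(3)[OF mp(2)] by blast
  qed
  then have "matching_pairs s = matching_pairs t" by auto
  then show "\<gamma> = \<delta>"
    using minus_plus_clan_equivI[OF mp] s t by (simp add: abs_clan_eq_iff)
qed

text \<open>The ones of \<open>A\<close> are read as pairs. The row and column conditions make these
  pairs disjoint, and symmetry of \<open>A\<close> makes the matching invariant under
  reversal.\<close>

lemma clan_matrix_surj: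
  assumes "A \<in> partial_involutions n"
  shows "\<exists>\<gamma> \<in> skew_symmetric_clans_over_minus_plus n. clan_matrix n \<gamma> = A"
proof -
  have carrier: "A \<in> carrier_mat n n" and trans: "transpose_mat A = A"
    and entries: "\<And>i j. i < n \<Longrightarrow> j < n \<Longrightarrow> A $$ (i, j) \<in> {0, 1}"
    and row: "\<And>i j k. i < n \<Longrightarrow> j < n \<Longrightarrow> k < n \<Longrightarrow> A $$ (i, j) = 1 \<Longrightarrow> A $$ (i, k) = 1 \<Longrightarrow> j = k"
    and col: "\<And>i j k. i < n \<Longrightarrow> j < n \<Longrightarrow> k < n \<Longrightarrow> A $$ (i, k) = 1 \<Longrightarrow> A $$ (j, k) = 1 \<Longrightarrow> i = j"
    using assms by (simp_all add: partial_involutions_def partial_permutation_matrix_iff)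
  have sym: "A $$ (j, i) = A $$ (i, j)" if "i < n" "j < n" for i j
    using that carrier index_transpose_mat(1)[of i A j] by (simp add: trans)
  define M where "M = {(i, j). i < n \<and> n \<le> j \<and> j < 2 * n \<and> A $$ (i, 2 * n - Suc j) = 1}"
  have unique: "p = q" if pq: "p \<in> M" "q \<in> M" "{fst p, snd p} \<inter> {fst q, snd q} \<noteq> {}" for p q
  proof -
    obtain i j where p: "p = (i, j)" by (cases p)
    obtain k l where q: "q = (k, l)" by (cases q)
    have b: "i < n" "n \<le> j" "j < 2 * n" "k < n" "n \<le> l" "l < 2 * n"
      "A $$ (i, 2 * n - Suc j) = 1" "A $$ (k, 2 * n - Suc l) = 1"
      using pq by (auto simp: M_def p q)
    then have lt: "2 * n - Suc j < n" "2 * n - Suc l < n" by auto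
    \<comment> \<open>Left ends lie below \<open>n\<close> and right ends do not, so pairs can meet
      only in two left ends or two right ends; \<open>row\<close> and \<open>col\<close> settle
      these cases.\<close>
    have "i = k \<or> j = l"
      using pq(3) b by (auto simp: p q)
    then have "i = k \<and> 2 * n - Suc j = 2 * n - Suc l"
      using row col b lt by metis
    then show ?thesis
      using b by (auto simp: p q)
  qed
  obtain s where s: "is_clan_string s" "length s = 2 * n" "matching_pairs s = M"
    and signs: "\<And>i. i < 2 * n \<Longrightarrow> \<not> is_Mate (s ! i) \<Longrightarrow> s ! i = (if i < n then SMinus else SPlus)"
    by (rule ex_clan_string[of M "2 * n" "\<lambda>i. if i < n then SMinus else SPlus"])
      (use unique in \<open>auto simp: M_def\<close>)
  have "minus_plus_string n s"
    using s signs unfolding minus_plus_string_def base_string_minus_plus_iff[OF s(1)]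
    by (auto simp: M_def)
  moreover have "matching_pairs (rev s) = matching_pairs s"
  proof -
    have "i < j \<and> j < 2 * n \<and> (2 * n - Suc j, 2 * n - Suc i) \<in> M \<longleftrightarrow> (i, j) \<in> M" for i j
    proof (cases "i < n \<and> n \<le> j \<and> j < 2 * n")
      case True
      then have "2 * n - Suc j < n" "2 * n - Suc (2 * n - Suc i) = i" by auto
      then show ?thesis
        using True sym[of i "2 * n - Suc j"] by (auto simp: M_def)
    next
      case False
      then show ?thesis
        by (auto simp: M_def)
    qed
    then show ?thesis
      by (simp add: matching_pairs_rev s)
  qed
  ultimately have "abs_clan s \<in> skew_symmetric_clans_over_minus_plus n"
    using s by (simp add: abs_clan_over_minus_plus_iff)
  moreover have "clan_matrix n (abs_clan s) = A"
  proof (rule eq_matI)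
    fix i j assume "i < dim_row A" "j < dim_col A"
    then have ij: "i < n" "j < n" using carrier by auto
    then have "2 * n - Suc (2 * n - Suc j) = j" by simp
    \<comment> \<open>Only the ones of \<open>A\<close> are stored in \<open>M\<close>;
      \<open>entries\<close> makes every other entry \<open>0\<close>.\<close>
    then show "clan_matrix n (abs_clan s) $$ (i, j) = A $$ (i, j)"
      using entries[OF ij] ij by (auto simp: clan_matrix_def clan_pairs_abs s M_def)
  qed (use carrier in \<open>auto simp: clan_matrix_def\<close>)
  ultimately show ?thesis by blast
qed

theorem theorem6p4:
  fixes n :: nat
  assumes "n \<ge> 1"
  shows "\<exists>f. bij_betw f (partial_involutions n) (skew_symmetric_clans_over_minus_plus n)"
proof -
  have "clan_matrix n ` skew_symmetric_clans_over_minus_plus n = partial_involutions n"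
    using clan_matrix_in_partial_involutions clan_matrix_surj by blast
  then have "bij_betw (clan_matrix n) (skew_symmetric_clans_over_minus_plus n) (partial_involutions n)"
    using clan_matrix_inj_on by (simp add: bij_betw_def)
  \<comment> \<open>The map constructed runs from clans to matrices; its inverse has the required
    direction.\<close>
  then show ?thesis
    using bij_betw_inv_into by blast
qed

end
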